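(* Let $\mathscr{A}$ be a $C^*$-algebra, $\mathscr{H}$ a Hilbert $\mathscr{A}$-module, and let $A\in\mathcal{L}(\mathscr{H})$ have the polar decomposition $A=U|A|$. If $A$ satisfies the generalized Cauchy--Schwarz inequality, i.e. $A\in GCSI(\mathscr{H})$, then $A$ is paranormal.
   Context: $\mathcal{L}(\mathscr{H})$ is the $C^*$-algebra of adjointable operators on the Hilbert $C^*$-module $(\mathscr{H},\langle\cdot,\cdot\rangle)$, with norm $\|x\|=\|\langle x,x\rangle\|^{1/2}$ on $\mathscr{H}$. $\mathcal{R}(\cdot)$ and $\mathcal{N}(\cdot)$ denote range and null space, and $|A|=(A^*A)^{1/2}$. An operator $A\in\mathcal{L}(\mathscr{H})$ satisfies the generalized Cauchy--Schwarz inequality if there exists $\lambda\in(0,1)$ such that $\|\langle Ax,y\rangle\|\le(\|Ax\|\,\|y\|)^{\lambda}(\|Ay\|\,\|x\|)^{1-\lambda}$ for all $x,y\in\mathscr{H}$; the collection of all such operators is $GCSI(\mathscr{H})$. An element $U\in\mathcal{L}(\mathscr{H})$ is a partial isometry if $U^*U$ is a projection in $\mathcal{L}(\mathscr{H})$. $A$ has the polar decomposition $A=U|A|$ if this equality holds with $U\in\mathcal{L}(\mathscr{H})$ a partial isometry such that $\mathcal{N}(U)=\mathcal{N}(A)$, $\mathcal{N}(U^* )=\mathcal{N}(A^* )$, $\mathcal{R}(U)=\overline{\mathcal{R}(A)}$, $\mathcal{R}(U^* )=\overline{\mathcal{R}(A^* )}$ (such a $U$ need not exist for a general adjointable $A$).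 $A$ is paranormal if $\|Ax\|^2\le\|A^2x\|\,\|x\|$ for every $x\in\mathscr{H}$. *)

theory Defs
  imports "HOL-Analysis.Analysis"
begin

class complex_banach = banach +
  fixes scaleC :: "complex \<Rightarrow> 'a \<Rightarrow> 'a"  (infixr \<open>*\<^sub>C\<close> 75)
  assumes scaleC_add_right: "c *\<^sub>C (x + y) = c *\<^sub>C x + c *\<^sub>C y"
    and scaleC_add_left: "(c + d) *\<^sub>C x = c *\<^sub>C x + d *\<^sub>C x"
    and scaleC_scaleC: "c *\<^sub>C d *\<^sub>C x = (c * d) *\<^sub>C x"
    and scaleC_of_real: "complex_of_real r *\<^sub>C x = r *\<^sub>R x"
    and norm_scaleC: "norm (c *\<^sub>C x) = cmod c * norm x"

text \<open>C*-algebras are not assumed to be unital.\<close>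

class cstar_algebra = complex_banach + real_normed_algebra +
  fixes star :: "'a \<Rightarrow> 'a"
  assumes mult_scaleC_left: "(c *\<^sub>C a) * b = c *\<^sub>C (a * b)"
    and mult_scaleC_right: "a * (c *\<^sub>C b) = c *\<^sub>C (a * b)"
    and star_add: "star (a + b) = star a + star b"
    and star_scaleC: "star (c *\<^sub>C a) = cnj c *\<^sub>C star a"
    and star_mult: "star (a * b) = star b * star a"
    and star_star: "star (star a) = a"
    and cstar_identity: "norm (star a * a) = (norm a)\<^sup>2"

definition cstar_positive :: "'a::cstar_algebra \<Rightarrow> bool" where
  "cstar_positive a \<longleftrightarrow> (\<exists>b. a = star b * b)"

text \<open>Hilbert C*-modules are right modules, with inner product linear in the second variable.
  Since a type class cannot refer to the algebra-valued inner product, the module carries a norm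
  from its type class; axiom \<open>norm_eq\<close> identifies it with the norm induced by the inner product,
  so that completeness and \<^const>\<open>closure\<close> refer to that norm.\<close>

locale hilbert_cstar_module =
  fixes act :: "'h::complex_banach \<Rightarrow> 'a::cstar_algebra \<Rightarrow> 'h"
    and ip :: "'h \<Rightarrow> 'h \<Rightarrow> 'a"
  assumes act_add_left: "act (x + y) a = act x a + act y a"
    and act_add_right: "act x (a + b) = act x a + act x b"
    and act_mult: "act x (a * b) = act (act x a) b"
    and act_scaleC_left: "act (c *\<^sub>C x) a = c *\<^sub>C act x a"
    and act_scaleC_right: "act x (c *\<^sub>C a) = c *\<^sub>C act x a"
    and ip_add: "ip x (y + z) = ip x y + ip x z"
    and ip_scaleC: "ip x (c *\<^sub>C y) = c *\<^sub>C ip x y"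
    and ip_act: "ip x (act y a) = ip x y * a"
    and ip_star: "star (ip x y) = ip y x"
    and ip_positive: "cstar_positive (ip x x)"
    and ip_definite: "ip x x = 0 \<Longrightarrow> x = 0"
    and norm_eq: "norm x = sqrt (norm (ip x x))"

text \<open>In the definitions below, \<open>ip\<close> is the inner product of a Hilbert C*-module. Adjointable maps
  are automatically linear, bounded and module maps, and their adjoints are unique.\<close>

definition is_adjoint ::
  "('h \<Rightarrow> 'h \<Rightarrow> 'a) \<Rightarrow> ('h \<Rightarrow> 'h) \<Rightarrow> ('h \<Rightarrow> 'h) \<Rightarrow> bool" where
  "is_adjoint ip A B \<longleftrightarrow> (\<forall>x y. ip (A x) y = ip x (B y))"

definition adjointables :: "('h \<Rightarrow> 'h \<Rightarrow> 'a) \<Rightarrow> ('h \<Rightarrow> 'h) set" where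
  "adjointables ip = {A. \<exists>B. is_adjoint ip A B}"

definition adj :: "('h \<Rightarrow> 'h \<Rightarrow> 'a) \<Rightarrow> ('h \<Rightarrow> 'h) \<Rightarrow> ('h \<Rightarrow> 'h)" where
  "adj ip A = (THE B. is_adjoint ip A B)"

text \<open>Positivity in the C*-algebra of adjointable operators, in the form used in
  \<^const>\<open>cstar_positive\<close>. The positive square root of a positive element is unique.\<close>

definition positive_op :: "('h \<Rightarrow> 'h \<Rightarrow> 'a) \<Rightarrow> ('h \<Rightarrow> 'h) \<Rightarrow> bool" where
  "positive_op ip P \<longleftrightarrow> (\<exists>C \<in> adjointables ip. P = adj ip C \<circ> C)"

definition sqrt_op :: "('h \<Rightarrow> 'h \<Rightarrow> 'a) \<Rightarrow> ('h \<Rightarrow> 'h) \<Rightarrow> ('h \<Rightarrow> 'h)" where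
  "sqrt_op ip T = (THE P. P \<in> adjointables ip \<and> positive_op ip P \<and> P \<circ> P = T)"

definition abs_op :: "('h \<Rightarrow> 'h \<Rightarrow> 'a) \<Rightarrow> ('h \<Rightarrow> 'h) \<Rightarrow> ('h \<Rightarrow> 'h)" where
  "abs_op ip A = sqrt_op ip (adj ip A \<circ> A)"

definition projection_op :: "('h \<Rightarrow> 'h \<Rightarrow> 'a) \<Rightarrow> ('h \<Rightarrow> 'h) \<Rightarrow> bool" where
  "projection_op ip P \<longleftrightarrow> P \<in> adjointables ip \<and> adj ip P = P \<and> P \<circ> P = P"

definition partial_isometry :: "('h \<Rightarrow> 'h \<Rightarrow> 'a) \<Rightarrow> ('h \<Rightarrow> 'h) \<Rightarrow> bool" where
  "partial_isometry ip U \<longleftrightarrow> U \<in> adjointables ip \<and> projection_op ip (adj ip U \<circ> U)"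

definition null_space :: "('h \<Rightarrow> 'h::zero) \<Rightarrow> 'h set" where
  "null_space A = {x. A x = 0}"

definition polar_decomposition ::
  "('h::complex_banach \<Rightarrow> 'h \<Rightarrow> 'a::cstar_algebra) \<Rightarrow> ('h \<Rightarrow> 'h) \<Rightarrow> ('h \<Rightarrow> 'h) \<Rightarrow> bool" where
  "polar_decomposition ip A U \<longleftrightarrow>
     partial_isometry ip U \<and>
     A = U \<circ> abs_op ip A \<and>
     null_space U = null_space A \<and>
     null_space (adj ip U) = null_space (adj ip A) \<and>
     range U = closure (range A) \<and>
     range (adj ip U) = closure (range (adj ip A))"

definition GCSI ::
  "('h::complex_banach \<Rightarrow> 'h \<Rightarrow> 'a::cstar_algebra) \<Rightarrow> ('h \<Rightarrow> 'h) set" where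
  "GCSI ip = {A \<in> adjointables ip. \<exists>l::real. 0 < l \<and> l < 1 \<and>
     (\<forall>x y. norm (ip (A x) y) \<le>
        (norm (A x) * norm y) powr l * (norm (A y) * norm x) powr (1 - l))}"

definition paranormal :: "('h::complex_banach \<Rightarrow> 'h) \<Rightarrow> bool" where
  "paranormal A \<longleftrightarrow> (\<forall>x. (norm (A x))\<^sup>2 \<le> norm (A (A x)) * norm x)"

end

theory Submission imports Defs begin

text \<open>The proof evaluates the generalized Cauchy--Schwarz inequality at \<open>y = A x\<close>. Its left side
  becomes \<open>s = \<parallel>A x\<parallel>\<^sup>2\<close>, and the same \<open>s\<close> is the base of the first factor on the right, so that
  \<open>s \<le> s\<^sup>\<lambda> t\<^sup>1\<^sup>-\<^sup>\<lambda>\<close> with \<open>t = \<parallel>A\<^sup>2 x\<parallel> \<parallel>x\<parallel>\<close>. Since \<open>\<lambda> < 1\<close>, a number bounded by a weighted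
  geometric mean of itself and \<open>t\<close> is at most \<open>t\<close>, which is paranormality.\<close>

lemma le_if_le_weighted_geometric_mean:
  fixes s t l :: real
  assumes "0 \<le> s" and "0 \<le> t" and "l < 1"
    and "s \<le> s powr l * t powr (1 - l)"
  shows "s \<le> t"
proof (rule ccontr)
  assume "\<not> s \<le> t"
  then have "t < s" and "0 < s"
    using \<open>0 \<le> t\<close> by auto
  then have "t powr (1 - l) < s powr (1 - l)"
    using \<open>0 \<le> t\<close> \<open>l < 1\<close> by (intro powr_less_mono2) auto
  then have "s powr l * t powr (1 - l) < s powr l * s powr (1 - l)"
    using \<open>0 < s\<close> by simp
  also have "\<dots> = s"
    using \<open>0 < s\<close> by (simp flip: powr_add)
  finally show False
    using assms(4) by simp
qed

lemma (in hilbert_cstar_module) norm_ip_self: "norm (ip x x) = (norm x)\<^sup>2"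
  by (simp add: norm_eq)

theorem theorem2p25:
  fixes act :: "'h::complex_banach \<Rightarrow> 'a::cstar_algebra \<Rightarrow> 'h"
    and ip :: "'h \<Rightarrow> 'h \<Rightarrow> 'a"
    and A U :: "'h \<Rightarrow> 'h"
  assumes "hilbert_cstar_module act ip"
    and "A \<in> adjointables ip"
    and "polar_decomposition ip A U"
    and "A \<in> GCSI ip"
  shows "paranormal A"
proof -
  interpret hilbert_cstar_module act ip
    by (rule assms(1))
  obtain l where "l < 1"
    and gcsi: "\<And>x y. norm (ip (A x) y)
      \<le> (norm (A x) * norm y) powr l * (norm (A y) * norm x) powr (1 - l)"
    using assms(4) by (auto simp: GCSI_def)
  have "(norm (A x))\<^sup>2 \<le> norm (A (A x)) * norm x" for x
  proof (rule le_if_le_weighted_geometric_mean)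
    show "(norm (A x))\<^sup>2
        \<le> ((norm (A x))\<^sup>2) powr l * (norm (A (A x)) * norm x) powr (1 - l)"
      using gcsi[of x "A x"] by (simp only: norm_ip_self power2_eq_square)
  qed (use \<open>l < 1\<close> in auto)
  then show ?thesis
    by (simp add: paranormal_def)
qed

end
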